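(* Let $n>0$ be an integer and let $I_n$ be the hypergeometric integral defined in the context. Then $$I_n = \sum_{\nu=n+1}^\infty \int_\nu^\infty \left(\frac{n!}{t(t+1)\cdots(t+n)}\right)^{2} dt.$$
   Context: The hypergeometric function ${}_3F_2$ is $${}_3F_2\biggl(\begin{matrix} a,\,b,\,c\\ d,\,e\end{matrix}\;\bigg|\; z\biggr) := \sum_{k=0}^\infty \frac{(a)_k(b)_k(c)_k}{k!\,(d)_k(e)_k}z^k,$$ where $(a)_0:=1$ and $(a)_k := a(a+1)\cdots(a+k-1)$ for $k>0$; for positive real parameters and $z=1$ the series converges if $a+b+c<d+e$. For an integer $n>0$, $$I_n := \int_{n+1}^\infty \frac{(n!)^2\,\Gamma(t)}{(2n+1)\,\Gamma(2n+1+t)}\ {}_3F_2\biggl(\begin{matrix} n+1,\,n+1,\,2n+1\\ 2n+2,\,2n+1+t\end{matrix}\;\bigg|\; 1\biggr)\,dt.$$ *)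

theory Defs
  imports "HOL-Analysis.Analysis"
begin

definition hypergeo_3F2 ::
  "'a \<Rightarrow> 'a \<Rightarrow> 'a \<Rightarrow> 'a \<Rightarrow> 'a \<Rightarrow> 'a \<Rightarrow> 'a :: {real_normed_field, banach}" where
  "hypergeo_3F2 a b c d e z =
     (\<Sum>k. pochhammer a k * pochhammer b k * pochhammer c k /
          (fact k * pochhammer d k * pochhammer e k) * z ^ k)"

lemma hypergeo_3F2_eq_eval_fps:
  "hypergeo_3F2 a b c d e z = eval_fps (fps_hypergeo [a, b, c] [d, e] 1) z"
  by (simp add: hypergeo_3F2_def eval_fps_def fps_hypergeo_def mult_ac)

definition I_integrand :: "nat \<Rightarrow> real \<Rightarrow> real" where
  "I_integrand n t =
     (fact n)\<^sup>2 * Gamma t / ((2 * real n + 1) * Gamma (2 * real n + 1 + t)) *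
     hypergeo_3F2 (real n + 1) (real n + 1) (2 * real n + 1)
                  (2 * real n + 2) (2 * real n + 1 + t) 1"

definition I_int :: "nat \<Rightarrow> real" where
  "I_int n = (LBINT t:{real n + 1..}. I_integrand n t)"

end

theory Submission
  imports Defs
begin

text \<open>
  Termwise, the hypergeometric series for \<open>I_integrand n t - I_integrand n (t + 1)\<close> is Gauss's series
  \<open>\<^sub>2F\<^sub>1(n + 1, n + 1; 2n + 2 + t; 1)\<close>, whose value makes the difference equal to
  \<open>(n! / (t (t + 1) \<dots> (t + n)))\<^sup>2\<close>. Since \<open>I_integrand n (t + m)\<close> tends to 0, telescoping expresses
  \<open>I_integrand n t\<close> as the sum of these squares over \<open>t, t + 1, \<dots>\<close>; integrating termwise and
  translating each term gives the claim.

  Gauss's theorem itself is obtained by integrating the binomial series of \<open>(1 - x)\<^sup>-\<^sup>a\<close>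
  against the weight \<open>x\<^sup>b\<^sup>-\<^sup>1 (1 - x)\<^sup>c\<^sup>-\<^sup>b\<^sup>-\<^sup>1\<close> on \<open>[0, 1]\<close>.
\<close>

section \<open>Gauss's summation theorem\<close>

lemma sums_one_minus_powr:
  fixes a x :: real
  assumes "\<bar>x\<bar> < 1"
  shows "(\<lambda>k. pochhammer a k / fact k * x ^ k) sums (1 - x) powr (- a)"
proof -
  have "(\<lambda>k. ((-a) gchoose k) * (-x) ^ k) sums (1 + (-x)) powr (- a)"
    by (rule gen_binomial_real) (use assms in simp)
  moreover have "((-a) gchoose k) * (-x) ^ k = pochhammer a k / fact k * x ^ k" for k
  \<comment> \<open>The generalized binomial coefficient carries a sign \<open>(-1) ^ k\<close>,
    which cancels that of \<open>(-x) ^ k\<close>.\<close>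
  proof -
    have "(-1 :: real) ^ k * (-x) ^ k = x ^ k"
      by (simp flip: power_mult_distrib)
    then show ?thesis
      by (simp add: gbinomial_pochhammer mult.commute mult.left_commute)
  qed
  ultimately show ?thesis by simp
qed

theorem gauss_hypergeo_sums:
  fixes a b c :: real
  assumes "a > 0" "b > 0" "c > a + b"
  shows "(\<lambda>k. pochhammer a k * pochhammer b k / (fact k * pochhammer c k))
           sums (Gamma c * Gamma (c - a - b) / (Gamma (c - a) * Gamma (c - b)))"
proof -
  \<comment> \<open>The \<open>f k\<close> are the terms of the binomial series times the Beta
    weight, and \<open>g\<close> is their sum. Each \<open>f k\<close> integrates to a multiple of
    \<open>Beta (b + k) (c - b)\<close>, and \<open>g\<close> to
    \<open>Beta b (c - a - b)\<close>.\<close>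
  define f where "f k x = pochhammer a k / fact k * (x powr (b + real k - 1) * (1 - x) powr (c - b - 1))"
    for k x
  define g where "g x = x powr (b - 1) * (1 - x) powr (c - a - b - 1)" for x
  have f_nonneg: "f k x \<ge> 0" for k x
    using assms by (auto simp: f_def intro!: divide_nonneg_nonneg mult_nonneg_nonneg pochhammer_nonneg)
  have f_meas [measurable]: "f k \<in> borel_measurable borel" for k
    unfolding f_def by measurable
  have f_int: "(\<integral>\<^sup>+x. ennreal (f k x) * indicator {0..1} x \<partial>lborel)
      = ennreal (pochhammer a k / fact k * Beta (b + k) (c - b))" for k
    unfolding f_def
    by (intro nn_integral_has_integral_lebesgue' has_integral_mult_right has_integral_Beta_real)
       (use assms in \<open>auto intro!: divide_nonneg_nonneg mult_nonneg_nonneg pochhammer_nonneg\<close>)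
  have g_int: "(\<integral>\<^sup>+x. ennreal (g x) * indicator {0..1} x \<partial>lborel) = ennreal (Beta b (c - a - b))"
    unfolding g_def
    by (intro nn_integral_has_integral_lebesgue' has_integral_Beta_real) (use assms in auto)
  have f_sums: "(\<lambda>k. f k x) sums g x" if x: "0 \<le> x" "x \<le> 1" for x
  proof (cases "x = 0 \<or> x = 1")
    case True
    then show ?thesis by (auto simp: f_def g_def)
  next
    case False
    with x have x': "0 < x" "x < 1" by auto
    have "(\<lambda>k. x powr (b - 1) * (1 - x) powr (c - b - 1) * (pochhammer a k / fact k * x ^ k))
        sums (x powr (b - 1) * (1 - x) powr (c - b - 1) * (1 - x) powr (-a))"
      by (intro sums_mult sums_one_minus_powr) (use x' in auto)
    moreover have "x powr (b - 1) * (1 - x) powr (c - b - 1) * (pochhammer a k / fact k * x ^ k) = f k x" for k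
    proof -
      have "x powr (b + real k - 1) = x powr (b - 1) * x ^ k"
        using x' by (simp add: powr_add [symmetric] powr_realpow [symmetric] algebra_simps)
      then show ?thesis by (simp add: f_def)
    qed
    moreover have "x powr (b - 1) * (1 - x) powr (c - b - 1) * (1 - x) powr (-a) = g x"
    proof -
      have "(1 - x) powr (c - b - 1) * (1 - x) powr (-a) = (1 - x) powr (c - a - b - 1)"
        by (simp add: powr_add [symmetric] algebra_simps)
      then show ?thesis by (simp add: g_def mult.assoc)
    qed
    ultimately show ?thesis by simp
  qed
  \<comment> \<open>Since the terms are nonnegative, sum and integral may be exchanged in
    \<open>ennreal\<close>; convergence of the real series then follows from finiteness of the Beta
    value.\<close>
  have "(\<Sum>k. ennreal (pochhammer a k / fact k * Beta (b + k) (c - b)))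
      = (\<integral>\<^sup>+x. (\<Sum>k. ennreal (f k x) * indicator {0..1} x) \<partial>lborel)"
    by (subst nn_integral_suminf) (auto simp: f_int)
  also have "\<dots> = (\<integral>\<^sup>+x. ennreal (g x) * indicator {0..1} x \<partial>lborel)"
  proof (intro nn_integral_cong)
    fix x :: real
    show "(\<Sum>k. ennreal (f k x) * indicator {0..1} x) = ennreal (g x) * indicator {0..1} x"
    proof (cases "x \<in> {0..1}")
      case True
      then have "(\<lambda>k. f k x) sums g x" using f_sums by auto
      then show ?thesis
        using True f_nonneg by (simp add: suminf_ennreal2 sums_iff)
    qed auto
  qed
  finally have "(\<Sum>k. ennreal (pochhammer a k / fact k * Beta (b + k) (c - b))) = ennreal (Beta b (c - a - b))"
    using g_int by simp
  moreover have Beta_nonneg: "Beta (b + real k) (c - b) \<ge> 0" "Beta b (c - a - b) \<ge> 0" for k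
    using assms by (auto simp: Beta_def intro!: divide_nonneg_nonneg mult_nonneg_nonneg Gamma_real_nonneg)
  ultimately have sums: "(\<lambda>k. pochhammer a k / fact k * Beta (b + k) (c - b)) sums Beta b (c - a - b)"
    using assms
    by (subst sums_ennreal [symmetric])
       (auto intro!: mult_nonneg_nonneg pochhammer_nonneg divide_nonneg_nonneg simp: sums_iff)
  have pos: "Gamma b > 0" "Gamma c > 0" "Gamma (c - b) > 0" "Gamma (c - a) > 0"
    using assms by (auto intro!: Gamma_real_pos)
  have poch: "pochhammer b k = Gamma (b + k) / Gamma b" "pochhammer c k = Gamma (c + k) / Gamma c" for k
    using assms by (auto intro!: pochhammer_Gamma elim!: nonpos_Ints_cases)
  have gk: "Gamma (c + real k) > 0" for k using assms by (auto intro!: Gamma_real_pos)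
  \<comment> \<open>Dividing by \<open>Beta b (c - b)\<close> turns
    \<open>Beta (b + k) (c - b)\<close> into the ratio of \<open>pochhammer b k\<close> to
    \<open>pochhammer c k\<close>.\<close>
  have "(\<lambda>k. Gamma c / (Gamma b * Gamma (c - b)) * (pochhammer a k / fact k * Beta (b + k) (c - b)))
      sums (Gamma c / (Gamma b * Gamma (c - b)) * Beta b (c - a - b))"
    by (rule sums_mult [OF sums])
  moreover have "Gamma c / (Gamma b * Gamma (c - b)) * (pochhammer a k / fact k * Beta (b + k) (c - b))
      = pochhammer a k * pochhammer b k / (fact k * pochhammer c k)" for k
    using pos gk [of k] by (simp add: poch Beta_def field_simps)
  moreover have "Gamma c / (Gamma b * Gamma (c - b)) * Beta b (c - a - b)
      = Gamma c * Gamma (c - a - b) / (Gamma (c - a) * Gamma (c - b))"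
    using pos by (simp add: Beta_def field_simps)
  ultimately show ?thesis by simp
qed

section \<open>Hypergeometric terms with the prefactor absorbed\<close>

definition I_term :: "nat \<Rightarrow> nat \<Rightarrow> real \<Rightarrow> real" where
  "I_term n k t = (fact n)\<^sup>2 * Gamma t * (pochhammer (real n + 1) k)\<^sup>2 /
     (fact k * (2 * real n + 1 + real k) * Gamma (2 * real n + 1 + t + real k))"

lemma I_term_nonneg: "t > 0 \<Longrightarrow> I_term n k t \<ge> 0"
  unfolding I_term_def
  by (intro divide_nonneg_nonneg mult_nonneg_nonneg Gamma_real_nonneg) auto

lemma I_term_plus1:
  assumes "t > 0"
  shows "I_term n k (t + 1) = t / (2 * real n + 1 + t + real k) * I_term n k t"
proof -
  have "Gamma (2 * real n + 1 + t + real k + 1)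
      = (2 * real n + 1 + t + real k) * Gamma (2 * real n + 1 + t + real k)"
    using assms by (intro Gamma_plus1) (auto elim!: nonpos_Ints_cases)
  moreover have "Gamma (t + 1) = t * Gamma t"
    using assms by (intro Gamma_plus1) (auto elim!: nonpos_Ints_cases)
  ultimately show ?thesis by (simp add: I_term_def add_ac mult_ac)
qed

text \<open>Put \<open>N = 2n + 1 + k\<close>. The shift multiplies a term by
  \<open>t / (N + t)\<close>, so the difference carries the factor \<open>N / (N + t)\<close>. Its
  numerator cancels the \<open>N\<close> in the denominator of \<open>I_term\<close> and leaves a
  2F1 series with \<open>a = b = n + 1\<close> and \<open>c = 2n + 2 + t\<close>. Gauss's value
  involves only \<open>c - a - b = t\<close> and \<open>c - a = c - b = t + n + 1\<close>, and the
  Gamma quotient is the reciprocal product.\<close>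

lemma I_term_diff_sums:
  assumes t: "t > 0"
  shows "(\<lambda>k. I_term n k t - I_term n k (t + 1)) sums (fact n / (\<Prod>j=0..n. t + real j))\<^sup>2"
proof -
  let ?c = "2 * real n + 2 + t" and ?a = "real n + 1"
  have pos: "Gamma t > 0" "Gamma ?c > 0" "Gamma (t + real (Suc n)) > 0"
    using t by (auto intro!: Gamma_real_pos)
  have "(\<lambda>k. pochhammer ?a k * pochhammer ?a k / (fact k * pochhammer ?c k))
      sums (Gamma ?c * Gamma (?c - ?a - ?a) / (Gamma (?c - ?a) * Gamma (?c - ?a)))"
    by (rule gauss_hypergeo_sums) (use t in auto)
  also have "?c - ?a - ?a = t" by simp
  also have "?c - ?a = t + real (Suc n)" by simp
  finally have "(\<lambda>k. (fact n)\<^sup>2 * Gamma t / Gamma ?c * (pochhammer ?a k * pochhammer ?a k / (fact k * pochhammer ?c k)))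
      sums ((fact n)\<^sup>2 * Gamma t / Gamma ?c *
        (Gamma ?c * Gamma t / (Gamma (t + real (Suc n)) * Gamma (t + real (Suc n)))))"
    by (rule sums_mult)
  moreover have "(fact n)\<^sup>2 * Gamma t / Gamma ?c *
        (Gamma ?c * Gamma t / (Gamma (t + real (Suc n)) * Gamma (t + real (Suc n))))
      = (fact n / (\<Prod>j=0..n. t + real j))\<^sup>2"
  proof -
    have "(\<Prod>j=0..n. t + real j) = pochhammer t (Suc n)"
      by (simp add: pochhammer_prod atLeastLessThanSuc_atLeastAtMost)
    also have "\<dots> = Gamma (t + real (Suc n)) / Gamma t"
      using t by (intro pochhammer_Gamma) (auto elim!: nonpos_Ints_cases)
    finally have prod_eq: "(\<Prod>j=0..n. t + real j) = Gamma (t + real (Suc n)) / Gamma t" .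
    show ?thesis unfolding prod_eq using pos by (simp add: power2_eq_square)
  qed
  moreover have "(fact n)\<^sup>2 * Gamma t / Gamma ?c * (pochhammer ?a k * pochhammer ?a k / (fact k * pochhammer ?c k))
      = I_term n k t - I_term n k (t + 1)" for k
  proof -
    let ?N = "2 * real n + 1 + real k"
    have poch: "pochhammer ?c k = Gamma (?c + real k) / Gamma ?c"
      using t by (intro pochhammer_Gamma) (auto elim!: nonpos_Ints_cases)
    have G: "Gamma (?c + real k) = (?N + t) * Gamma (?N + t)"
    proof -
      have "Gamma (?N + t + 1) = (?N + t) * Gamma (?N + t)"
        using t by (intro Gamma_plus1) (auto elim!: nonpos_Ints_cases)
      then show ?thesis by (simp add: add_ac)
    qed
    have Np: "?N > 0" "?N + t > 0" using t by auto
    have GN: "Gamma (?N + t) > 0" using t by (auto intro!: Gamma_real_pos)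
    have "I_term n k t - I_term n k (t + 1) = ?N / (?N + t) * I_term n k t"
    proof -
      have "2 * real n + 1 + t + real k = ?N + t" by simp
      then show ?thesis
        using Np by (simp only: I_term_plus1 [OF t]) (simp add: divide_simps algebra_simps)
    qed
    moreover have "I_term n k t = (fact n)\<^sup>2 * Gamma t * (pochhammer ?a k)\<^sup>2 / (fact k * ?N * Gamma (?N + t))"
      by (simp add: I_term_def add_ac)
    ultimately show ?thesis
      unfolding poch G using Np GN pos by (simp add: power2_eq_square mult_ac)
  qed
  ultimately show ?thesis by simp
qed

text \<open>Convergence is inherited from the difference series just summed: because
  \<open>N = 2n + 1 + k\<close> is at least 1, \<open>N + t \<le> (1 + t) * N\<close>, so each term
  is at most \<open>1 + t\<close> times the corresponding difference.\<close>

lemma I_term_summable: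
  assumes t: "t > 0"
  shows "summable (\<lambda>k. I_term n k t)"
proof (rule summable_comparison_test')
  show "summable (\<lambda>k. (1 + t) * (I_term n k t - I_term n k (t + 1)))"
    using I_term_diff_sums [OF t, of n] by (intro summable_mult) (auto simp: sums_iff)
  fix k
  let ?N = "2 * real n + 1 + real k"
  have "1 * I_term n k t \<le> (1 + t) * (?N / (?N + t)) * I_term n k t"
  proof (rule mult_right_mono)
    have "?N \<ge> 1" by simp
    then have "t * 1 \<le> t * ?N" using t by (intro mult_left_mono) auto
    with \<open>?N \<ge> 1\<close> t show "1 \<le> (1 + t) * (?N / (?N + t))"
      by (simp add: field_simps)
  qed (rule I_term_nonneg [OF t])
  also have "\<dots> = (1 + t) * (I_term n k t - I_term n k (t + 1))"
  proof -
    have "?N + t > 0" using t by simp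
    moreover have "2 * real n + 1 + t + real k = ?N + t" by simp
    ultimately show ?thesis by (simp only: I_term_plus1 [OF t]) (simp add: divide_simps algebra_simps)
  qed
  finally show "norm (I_term n k t) \<le> (1 + t) * (I_term n k t - I_term n k (t + 1))"
    using I_term_nonneg [OF t] by simp
qed

lemma I_integrand_eq_suminf:
  assumes t: "t > 0"
  shows "I_integrand n t = (\<Sum>k. I_term n k t)"
proof -
  let ?m = "2 * real n + 1"
  let ?C = "(fact n)\<^sup>2 * Gamma t / (?m * Gamma (?m + t))"
  have term_eq: "I_term n k t = ?C * (pochhammer (real n + 1) k * pochhammer (real n + 1) k * pochhammer ?m k /
          (fact k * pochhammer (2 * real n + 2) k * pochhammer (?m + t) k) * 1 ^ k)" for k
  proof -
    \<comment> \<open>Splitting off the last and then the first factor of the same symbol shows that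
      the parameters \<open>2n + 1\<close> and \<open>2n + 2\<close> contribute only
      \<open>(2n + 1) / (2n + 1 + k)\<close>.\<close>
    have "pochhammer ?m (Suc k) = pochhammer ?m k * (?m + k)"
      by (rule pochhammer_Suc)
    moreover have "pochhammer ?m (Suc k) = ?m * pochhammer (2 * real n + 2) k"
      by (simp add: pochhammer_rec add_ac)
    ultimately have p: "pochhammer ?m k = ?m * pochhammer (2 * real n + 2) k / (?m + k)"
      by (simp add: field_simps)
    have q: "pochhammer (?m + t) k = Gamma (?m + t + real k) / Gamma (?m + t)"
      using t by (intro pochhammer_Gamma) (auto elim!: nonpos_Ints_cases)
    have pos: "Gamma (?m + t) > 0" "pochhammer (2 * real n + 2) k > 0" "?m > 0"
      using t by (auto intro!: Gamma_real_pos pochhammer_pos)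
    then show ?thesis
      unfolding p q by (simp add: I_term_def power2_eq_square mult_ac)
  qed
  \<comment> \<open>Pulling the prefactor out of the sum requires summability of the bare series,
    which follows because the prefactor is nonzero.\<close>
  then have "summable (\<lambda>k. ?C * (pochhammer (real n + 1) k * pochhammer (real n + 1) k * pochhammer ?m k /
          (fact k * pochhammer (2 * real n + 2) k * pochhammer (?m + t) k) * 1 ^ k))"
    using I_term_summable [OF t, of n] by simp
  moreover have "Gamma (?m + t) > 0" "Gamma t > 0"
    using t by (auto intro!: Gamma_real_pos)
  then have "?C \<noteq> 0" by (simp add: add_eq_0_iff)
  ultimately have "summable (\<lambda>k. pochhammer (real n + 1) k * pochhammer (real n + 1) k * pochhammer ?m k /
          (fact k * pochhammer (2 * real n + 2) k * pochhammer (?m + t) k) * 1 ^ k)"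
    by (subst (asm) summable_cmult_iff) auto
  then show ?thesis
    unfolding term_eq I_integrand_def hypergeo_3F2_def by (subst suminf_mult) auto
qed

section \<open>Telescoping under unit shifts\<close>

lemma I_integrand_diff:
  assumes t: "t > 0"
  shows "I_integrand n t - I_integrand n (t + 1) = (fact n / (\<Prod>j=0..n. t + real j))\<^sup>2"
proof -
  have "(\<lambda>k. I_term n k t - I_term n k (t + 1)) sums (I_integrand n t - I_integrand n (t + 1))"
    using t by (auto intro!: sums_diff summable_sums I_term_summable simp: I_integrand_eq_suminf)
  then show ?thesis using I_term_diff_sums [OF t] sums_unique2 by blast
qed

lemma I_integrand_nonneg: "t > 0 \<Longrightarrow> I_integrand n t \<ge> 0"
  by (simp add: I_integrand_eq_suminf suminf_nonneg I_term_summable I_term_nonneg)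

text \<open>The termwise ratio \<open>t / (2n + 1 + t + k)\<close> is at most
  \<open>t / (t + 1)\<close> uniformly in \<open>k\<close>.\<close>

lemma I_integrand_plus1_le:
  assumes t: "t > 0"
  shows "I_integrand n (t + 1) \<le> t / (t + 1) * I_integrand n t"
proof -
  have "(\<Sum>k. I_term n k (t + 1)) \<le> (\<Sum>k. t / (t + 1) * I_term n k t)"
  proof (intro suminf_le summable_mult I_term_summable)
    fix k
    show "I_term n k (t + 1) \<le> t / (t + 1) * I_term n k t"
      unfolding I_term_plus1 [OF t]
      by (intro mult_right_mono divide_left_mono I_term_nonneg t mult_pos_pos) (use t in auto)
  qed (use t in auto)
  with t show ?thesis
    by (simp only: I_integrand_eq_suminf suminf_mult I_term_summable)
qed

text \<open>The one-step factors \<open>(t + i) / (t + i + 1)\<close> multiply to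
  \<open>t / (t + m)\<close>, an explicit rate of decay for the remainder of the telescoping
  sum.\<close>

lemma I_integrand_plus_le:
  assumes t: "t > 0"
  shows "I_integrand n (t + real m) \<le> t / (t + real m) * I_integrand n t"
proof (induction m)
  case (Suc m)
  have "I_integrand n (t + real m + 1) \<le> (t + real m) / (t + real m + 1) * I_integrand n (t + real m)"
    by (rule I_integrand_plus1_le) (use t in auto)
  also have "\<dots> \<le> (t + real m) / (t + real m + 1) * (t / (t + real m) * I_integrand n t)"
    by (intro mult_left_mono Suc.IH) (use t in auto)
  also have "\<dots> = t / (t + real (Suc m)) * I_integrand n t"
    using t by (simp add: add_ac)
  finally show ?case by (simp add: add_ac)
qed (use t in auto)

lemma I_integrand_shift_tendsto_0:
  assumes t: "t > 0"
  shows "(\<lambda>m. I_integrand n (t + real m)) \<longlonglongrightarrow> 0"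
proof (rule tendsto_sandwich [where f = "\<lambda>_. 0"])
  show "(\<lambda>m. t / (t + real m) * I_integrand n t) \<longlonglongrightarrow> 0"
    by (intro tendsto_mult_left_zero tendsto_divide_0 [OF tendsto_const]
        filterlim_at_top_imp_at_infinity filterlim_tendsto_add_at_top [OF tendsto_const]
        filterlim_real_sequentially)
  show "\<forall>\<^sub>F m in sequentially. 0 \<le> I_integrand n (t + real m)"
    using t by (auto intro!: always_eventually I_integrand_nonneg)
qed (use I_integrand_plus_le [OF t] in auto)

lemma I_integrand_sums:
  assumes t: "t > 0"
  shows "(\<lambda>m. (fact n / (\<Prod>j=0..n. t + real m + real j))\<^sup>2) sums I_integrand n t"
proof -
  have "(\<lambda>m. I_integrand n (t + real m) - I_integrand n (t + real (Suc m))) sums (I_integrand n (t + real 0) - 0)"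
    by (rule telescope_sums') (rule I_integrand_shift_tendsto_0 [OF t])
  moreover have "I_integrand n (t + real m) - I_integrand n (t + real (Suc m))
      = (fact n / (\<Prod>j=0..n. t + real m + real j))\<^sup>2" for m
    using I_integrand_diff [of "t + real m" n] t by (simp add: add_ac)
  ultimately show ?thesis by simp
qed

section \<open>Bounds and integrability of the squared kernel\<close>

lemma kernel_le:
  fixes t :: real
  assumes "n > 0" "t \<ge> 1"
  shows "(fact n / (\<Prod>j=0..n. t + real j))\<^sup>2 \<le> (fact n)\<^sup>2 * (1 / t ^ 3)"
proof -
  \<comment> \<open>As \<open>n > 0\<close>, the product has at least two factors, each at least
    \<open>t\<close>, so its square is at least \<open>t ^ 4\<close>. The cubic bound kept below is
    enough: its tail integral is of order \<open>1 / a ^ 2\<close>, summable over integers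
    \<open>a\<close>.\<close>
  have "t ^ 2 \<le> t ^ Suc n" using assms by (intro power_increasing) auto
  also have "\<dots> = (\<Prod>j=0..n. t)" by simp
  also have "\<dots> \<le> (\<Prod>j=0..n. t + real j)"
    using assms by (intro prod_mono) auto
  finally have "(t ^ 2) ^ 2 \<le> (\<Prod>j=0..n. t + real j) ^ 2"
    by (intro power_mono) auto
  moreover have "t ^ 3 \<le> t ^ 4" using assms by (intro power_increasing) auto
  ultimately have "t ^ 3 \<le> (\<Prod>j=0..n. t + real j) ^ 2" by (simp flip: power_mult)
  then have "(fact n)\<^sup>2 / (\<Prod>j=0..n. t + real j) ^ 2 \<le> (fact n)\<^sup>2 / t ^ 3"
    using assms by (intro divide_left_mono mult_pos_pos) (auto intro!: zero_less_power prod_pos)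
  then show ?thesis by (simp add: power_divide)
qed

lemma set_integral_inverse_power_to_inf:
  fixes a :: real
  assumes "m > 1" "a > 0"
  shows "set_integrable lborel {a..} (\<lambda>x. 1 / x ^ m)"
    and "(LBINT x:{a..}. 1 / x ^ m) = 1 / (real (m - 1) * a ^ (m - 1))"
proof -
  have "(\<integral>\<^sup>+x. ennreal (indicator {a..} x * (1 / x ^ m)) \<partial>lborel)
      = ennreal (1 / (real (m - 1) * a ^ (m - 1)))"
    by (intro nn_integral_has_integral_lebesgue has_integral_inverse_power_to_inf)
       (use assms in auto)
  then have "has_bochner_integral lborel (\<lambda>x. indicator {a..} x * (1 / x ^ m))
      (1 / (real (m - 1) * a ^ (m - 1)))"
    using assms by (intro has_bochner_integral_nn_integral) (auto simp: indicator_def)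
  then show "set_integrable lborel {a..} (\<lambda>x. 1 / x ^ m)"
      "(LBINT x:{a..}. 1 / x ^ m) = 1 / (real (m - 1) * a ^ (m - 1))"
    by (simp_all add: has_bochner_integral_iff set_integrable_def set_lebesgue_integral_def)
qed

lemma
  fixes a :: real
  assumes "n > 0" "a \<ge> 1"
  shows kernel_set_integrable: "set_integrable lborel {a..} (\<lambda>t. (fact n / (\<Prod>j=0..n. t + real j))\<^sup>2)"
    and kernel_set_integral_le: "(LBINT t:{a..}. (fact n / (\<Prod>j=0..n. t + real j))\<^sup>2) \<le> (fact n)\<^sup>2 / a\<^sup>2"
proof -
  have int: "set_integrable lborel {a..} (\<lambda>x. (fact n)\<^sup>2 * (1 / x ^ 3))"
    using assms by (intro set_integrable_mult_right set_integral_inverse_power_to_inf) auto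
  show *: "set_integrable lborel {a..} (\<lambda>t. (fact n / (\<Prod>j=0..n. t + real j))\<^sup>2)"
  proof (rule set_integrable_bound [OF int])
    show "set_borel_measurable lborel {a..} (\<lambda>t. (fact n / (\<Prod>j=0..n. t + real j))\<^sup>2)"
      unfolding set_borel_measurable_def by measurable
    show "AE x in lborel. x \<in> {a..} \<longrightarrow> norm ((fact n / (\<Prod>j=0..n. x + real j))\<^sup>2)
        \<le> norm ((fact n)\<^sup>2 * (1 / x ^ 3))"
    proof (intro AE_I2 impI)
      fix x :: real assume "x \<in> {a..}"
      then have "x \<ge> 1" using assms by auto
      then show "norm ((fact n / (\<Prod>j=0..n. x + real j))\<^sup>2) \<le> norm ((fact n)\<^sup>2 * (1 / x ^ 3))"
        using kernel_le [OF assms(1), of x] by simp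
    qed
  qed
  have "(LBINT t:{a..}. (fact n / (\<Prod>j=0..n. t + real j))\<^sup>2) \<le> (LBINT x:{a..}. (fact n)\<^sup>2 * (1 / x ^ 3))"
    by (intro set_integral_mono * int kernel_le) (use assms in auto)
  also have "\<dots> = (fact n)\<^sup>2 * (1 / (2 * a\<^sup>2))"
    using set_integral_inverse_power_to_inf(2) [of 3 a] assms
    by (subst set_integral_mult_right) simp
  also have "\<dots> \<le> (fact n)\<^sup>2 / a\<^sup>2"
    using assms by (simp add: field_simps)
  finally show "(LBINT t:{a..}. (fact n / (\<Prod>j=0..n. t + real j))\<^sup>2) \<le> (fact n)\<^sup>2 / a\<^sup>2" .
qed

section \<open>Translation of half-lines and termwise integration\<close>

lemma
  fixes f :: "real \<Rightarrow> real"
  shows set_integrable_atLeast_shift: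
      "set_integrable lborel {a + c..} f \<Longrightarrow> set_integrable lborel {a..} (\<lambda>x. f (x + c))"
    and set_integral_atLeast_shift:
      "(LBINT x:{a..}. f (x + c)) = (LBINT x:{a + c..}. f x)"
proof -
  have ind: "indicator {a + c..} (c + 1 * x) = (indicator {a..} x :: real)" for x
    by (auto simp: indicator_def)
  show "set_integrable lborel {a..} (\<lambda>x. f (x + c))" if "set_integrable lborel {a + c..} f"
    using lborel_integrable_real_affine [of "\<lambda>x. indicator {a + c..} x *\<^sub>R f x" 1 c] that
    unfolding set_integrable_def by (simp only: ind) (simp add: add.commute)
  show "(LBINT x:{a..}. f (x + c)) = (LBINT x:{a + c..}. f x)"
    using lborel_integral_real_affine [of 1 "\<lambda>x. indicator {a + c..} x *\<^sub>R f x" c]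
    unfolding set_lebesgue_integral_def by (simp only: ind) (simp add: add.commute)
qed

theorem lemma1:
  fixes n :: nat
  assumes "n > 0"
  shows "set_integrable lborel {real n + 1..} (I_integrand n) \<and>
         (\<forall>\<nu>\<ge>n + 1. set_integrable lborel {real \<nu>..}
            (\<lambda>t. (fact n / (\<Prod>j=0..n. t + real j))\<^sup>2)) \<and>
         (\<lambda>k. LBINT t:{real (n + 1 + k)..}. (fact n / (\<Prod>j=0..n. t + real j))\<^sup>2)
           sums I_int n"
proof -
  define K where "K t = (fact n / (\<Prod>j=0..n. t + real j))\<^sup>2" for t :: real
  \<comment> \<open>Translating by \<open>k\<close> puts all integrals on the common domain
    \<open>{n + 1..}\<close>; the summation index of the claim is
    \<open>\<nu> = n + 1 + k\<close>.\<close>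
  define f where "f k t = indicator {real n + 1..} t *\<^sub>R K (t + real k)" for k t
  have eq: "real n + 1 + real k = real (n + 1 + k)" for k by simp
  have K_int: "set_integrable lborel {a..} K" if "a \<ge> 1" for a
    unfolding K_def by (rule kernel_set_integrable [OF assms that])
  have f_nonneg: "f k t \<ge> 0" for k t by (simp add: f_def K_def)
  have f_integral: "integral\<^sup>L lborel (f k) = (LBINT t:{real (n + 1 + k)..}. K t)" for k
    using set_integral_atLeast_shift [of "real n + 1" K "real k"]
    unfolding eq by (simp add: set_lebesgue_integral_def f_def [abs_def])
  have f_sums: "(\<lambda>k. f k t) sums (indicator {real n + 1..} t *\<^sub>R I_integrand n t)" for t
  proof (cases "t \<ge> real n + 1")
    case True
    then have "t > 0" by simp
    from I_integrand_sums [OF this, of n] True show ?thesis by (simp add: f_def K_def)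
  qed (simp add: f_def)
  have f_integrable: "integrable lborel (f k)" for k
    using set_integrable_atLeast_shift [OF K_int, of "real n + 1" "real k"]
    by (simp add: set_integrable_def f_def [abs_def])
  have AE: "AE t in lborel. summable (\<lambda>k. norm (f k t))"
    using f_sums f_nonneg by (auto simp: sums_iff)
  have summable: "summable (\<lambda>k. LBINT t. norm (f k t))"
  proof (rule summable_comparison_test')
    \<comment> \<open>The shift to \<open>k + 1\<close> keeps the bound positive at
      \<open>k = 0\<close>, where \<open>inverse 0 = 0\<close> would be too small.\<close>
    have "summable (\<lambda>k. inverse (real (k + 1) ^ 2))"
      using inverse_power_summable [of 2, where 'a=real] by (subst summable_iff_shift) auto
    then show "summable (\<lambda>k. (fact n)\<^sup>2 * inverse (real (k + 1) ^ 2))"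
      by (rule summable_mult)
    fix k
    have "(LBINT t:{real (n + 1 + k)..}. K t) \<le> (fact n)\<^sup>2 / (real (n + 1 + k))\<^sup>2"
      unfolding K_def by (rule kernel_set_integral_le) (use assms in auto)
    also have "\<dots> \<le> (fact n)\<^sup>2 / (real (k + 1))\<^sup>2"
      by (intro divide_left_mono power_mono) auto
    finally have "integral\<^sup>L lborel (f k) \<le> (fact n)\<^sup>2 / (real (k + 1))\<^sup>2"
      unfolding f_integral .
    then show "norm (LBINT t. norm (f k t)) \<le> (fact n)\<^sup>2 * inverse (real (k + 1) ^ 2)"
      using f_nonneg by (simp add: divide_inverse)
  qed
  have suminf_eq: "(\<Sum>k. f k t) = indicator {real n + 1..} t *\<^sub>R I_integrand n t" for t
    using f_sums by (simp add: sums_iff)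
  \<comment> \<open>Measurability and integrability of the hypergeometric integrand come from its
    expansion into the functions \<open>f k\<close>.\<close>
  have "set_integrable lborel {real n + 1..} (I_integrand n)"
    using integrable_suminf [OF f_integrable AE summable]
    by (simp add: suminf_eq set_integrable_def)
  moreover have "(\<lambda>k. LBINT t:{real (n + 1 + k)..}. K t) sums I_int n"
    using sums_integral [OF f_integrable AE summable]
    by (simp only: f_integral suminf_eq I_int_def set_lebesgue_integral_def)
  moreover have "\<forall>\<nu>\<ge>n + 1. set_integrable lborel {real \<nu>..} K"
    by (intro allI impI K_int) simp
  ultimately show ?thesis unfolding K_def by blast
qed

end
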